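(* Let $n\ge m\ge1$ be integers. The second order differential operator $$x\frac{\partial}{\partial x}+\sum_{k=1}^m\Big(\lambda_k\frac{\partial^2}{\partial\lambda_k^2}+(n-m+1-\lambda_k)\frac{\partial}{\partial\lambda_k}-n\Big)+\frac{m(m-1)}{2}+1$$ annihilates the function $\mathcal{R}_{n,m}(x,\lambda_1,\ldots,\lambda_m)$.
   Context: For a positive integer $a$, ${}_0F_1(a;z)=\sum_{k=0}^\infty \frac{z^k}{(a)_k\,k!}$ with $(a)_k=a(a+1)\cdots(a+k-1)$. For integers $k\ge 0$, $a\ge1$, put $$H^k_a(x,y)=\int_0^x t^k e^{-t}\,{}_0F_1(a;ty)\,dt .$$ For integers $n\ge m\ge1$ define $$\mathcal{R}_{n,m}(x,\lambda_1,\ldots,\lambda_m)=\frac{\partial}{\partial x}\det\Big(H^{n-j}_{n-m+1}(x,\lambda_i)\Big)_{i,j=1}^m ,$$ where $i$ is the row index and $j$ the column index. *)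

theory Defs
  imports "HOL-Analysis.Analysis" "Jordan_Normal_Form.Determinant"
begin

definition hyp0F1 :: "nat \<Rightarrow> real \<Rightarrow> real" where
  "hyp0F1 a z = (\<Sum>k. z ^ k / (pochhammer (real a) k * fact k))"

text \<open>The integral is oriented, so the definition covers all real \<open>x\<close>, with
  \<open>\<integral>\<^sub>0\<^sup>x = - \<integral>\<^sub>x\<^sup>0\<close> for negative \<open>x\<close>.\<close>

definition Hint :: "nat \<Rightarrow> nat \<Rightarrow> real \<Rightarrow> real \<Rightarrow> real" where
  "Hint k a x y = (LBINT t=0..x. t ^ k * exp (- t) * hyp0F1 a (t * y))"

text \<open>The parameters \<open>\<lambda>\<^sub>1, \<dots>, \<lambda>\<^sub>m\<close> are the values at \<open>1, \<dots>, m\<close> of \<open>lam :: nat \<Rightarrow> real\<close>; other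
  values are never used. Matrix indices start at 0, so the entry at position \<open>(i, j)\<close> is the one
  the mathematics places in row \<open>i + 1\<close> and column \<open>j + 1\<close>.\<close>

definition Hmat :: "nat \<Rightarrow> nat \<Rightarrow> real \<Rightarrow> (nat \<Rightarrow> real) \<Rightarrow> real mat" where
  "Hmat n m x lam =
     Matrix.mat m m (\<lambda>(i, j). Hint (n - (j + 1)) (n - m + 1) x (lam (i + 1)))"

definition Rfun :: "nat \<Rightarrow> nat \<Rightarrow> real \<Rightarrow> (nat \<Rightarrow> real) \<Rightarrow> real" where
  "Rfun n m x lam = deriv (\<lambda>u. Determinant.det (Hmat n m u lam)) x"

definition partial_x :: "(real \<Rightarrow> (nat \<Rightarrow> real) \<Rightarrow> real) \<Rightarrow> real \<Rightarrow> (nat \<Rightarrow> real) \<Rightarrow> real" where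
  "partial_x f x lam = deriv (\<lambda>u. f u lam) x"

definition partial_lam ::
  "nat \<Rightarrow> (real \<Rightarrow> (nat \<Rightarrow> real) \<Rightarrow> real) \<Rightarrow> real \<Rightarrow> (nat \<Rightarrow> real) \<Rightarrow> real" where
  "partial_lam k f x lam = deriv (\<lambda>s. f x (lam(k := s))) (lam k)"

definition diff_op ::
  "nat \<Rightarrow> nat \<Rightarrow> (real \<Rightarrow> (nat \<Rightarrow> real) \<Rightarrow> real) \<Rightarrow> real \<Rightarrow> (nat \<Rightarrow> real) \<Rightarrow> real" where
  "diff_op n m f x lam =
     x * partial_x f x lam
     + (\<Sum>k = 1..m. lam k * partial_lam k (partial_lam k f) x lam
          + (real n - real m + 1 - lam k) * partial_lam k f x lam
          - real n * f x lam)
     + (real m * (real m - 1) / 2 + 1) * f x lam"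

end

theory Submission
  imports Defs
begin

text \<open>Put \<open>a = n - m + 1\<close>, and let \<open>L\<^sub>y = y \<partial>\<^sub>y\<^sup>2 + (a - y) \<partial>\<^sub>y\<close>. The operator of the theorem is
  \<open>x \<partial>\<^sub>x + \<Sum>\<^sub>k L\<^bsub>\<lambda>k\<^esub>\<close> plus a constant, so the claim is that \<open>\<R>\<close> is an eigenfunction of this
  operator with the right eigenvalue.

  The integrand \<open>g\<^sub>k(t, y) = t\<^sup>k e\<^sup>-\<^sup>t \<^sub>0F\<^sub>1(a; t y)\<close> satisfies \<open>(t \<partial>\<^sub>t + L\<^sub>y) g\<^sub>k = k g\<^sub>k\<close>
  (\<open>integrand_pde\<close>), by the differential equation of \<open>\<^sub>0F\<^sub>1\<close>. Integrating over \<open>t\<close> from \<open>0\<close> to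
  \<open>x\<close> gives \<open>(x \<partial>\<^sub>x + L\<^sub>y) H\<^sup>k = (k + 1) H\<^sup>k\<close> (\<open>Hint_pde\<close>), where \<open>\<partial>\<^sub>x H\<^sup>k = g\<^sub>k\<close>.

  By the Leibniz expansion of the determinant and the product rule, \<open>\<R>\<close> is a linear combination
  of products with one factor for each \<open>\<lambda>\<^sub>l\<close>, where a single factor is some \<open>g\<^sub>k\<close> and all
  others are some \<open>H\<^sup>k\<close> (\<open>Rfun_expansion\<close>). Eigenvalues of separated factors add up
  (\<open>eigenfun_prod\<close>). In every product the exponents \<open>k\<close> are a rearrangement of
  \<open>n - 1, \<dots>, n - m\<close>, so all products have the same eigenvalue
  \<open>\<Sum>\<^sub>j (n - j + 1) - 1 = n m - m (m - 1) / 2 - 1\<close>; the \<open>-1\<close> is due to the one differentiated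
  factor. The constant in the operator is the negative of this number.\<close>

section \<open>The function \<open>\<^sub>0F\<^sub>1\<close>\<close>

lemma pochhammer_ge_one:
  fixes a :: real
  assumes "1 \<le> a"
  shows "1 \<le> pochhammer a k"
proof (induction k)
  case (Suc k)
  have "1 * 1 \<le> pochhammer a k * (a + real k)"
    using Suc assms by (intro mult_mono) auto
  then show ?case by (simp add: pochhammer_Suc)
qed simp

lemma summable_hyp0F1:
  assumes "1 \<le> a"
  shows "summable (\<lambda>k. 1 / (pochhammer (real a) k * fact k) * z ^ k)"
proof (rule summable_comparison_test')
  show "summable (\<lambda>k. inverse (fact k) * \<bar>z\<bar> ^ k)"
    by (rule summable_exp)
  fix k :: nat
  have p: "1 \<le> pochhammer (real a) k" using assms by (intro pochhammer_ge_one) simp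
  have "1 * fact k \<le> pochhammer (real a) k * fact k"
    using p by (intro mult_right_mono) auto
  then have "1 / (pochhammer (real a) k * fact k) \<le> inverse (fact k)"
    by (auto simp: divide_simps)
  then have "1 / (pochhammer (real a) k * fact k) * \<bar>z\<bar> ^ k \<le> inverse (fact k) * \<bar>z\<bar> ^ k"
    by (rule mult_right_mono) simp
  then show "norm (1 / (pochhammer (real a) k * fact k) * z ^ k) \<le> inverse (fact k) * \<bar>z\<bar> ^ k"
    using p by (simp add: abs_mult power_abs)
qed

lemma hyp0F1_sums:
  assumes "1 \<le> a"
  shows "(\<lambda>k. z ^ k / (pochhammer (real a) k * fact k)) sums hyp0F1 a z"
  using summable_sums[OF summable_hyp0F1[OF assms, of z]] by (simp add: hyp0F1_def)

text \<open>Because \<open>(a)\<^bsub>k+1\<^esub> = a (a+1)\<^sub>k\<close>, differentiation stays in the family and raises the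
  parameter. The \<open>y\<close>-derivatives of the integrand and of its integral therefore have closed forms,
  with \<open>k\<close> and \<open>a\<close> both raised by one.\<close>

lemma hyp0F1_deriv:
  assumes "1 \<le> a"
  shows "(hyp0F1 a has_real_derivative hyp0F1 (Suc a) z / real a) (at z)"
proof -
  let ?c = "\<lambda>k. 1 / (pochhammer (real a) k * fact k)"
  have "((\<lambda>z. \<Sum>k. ?c k * z ^ k) has_real_derivative (\<Sum>k. diffs ?c k * z ^ k)) (at z)"
    by (rule termdiffs_strong_converges_everywhere) (rule summable_hyp0F1[OF assms])
  moreover have "diffs ?c k * z ^ k = z ^ k / (pochhammer (real (Suc a)) k * fact k) / real a" for k
    unfolding diffs_def pochhammer_rec fact_Suc of_nat_Suc[of a] add.commute[of 1 "real a"]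
    by (simp del: of_nat_Suc)
  then have "(\<Sum>k. diffs ?c k * z ^ k) = hyp0F1 (Suc a) z / real a"
    using sums_divide[OF hyp0F1_sums[of "Suc a" z], of "real a"] by (simp add: sums_iff)
  ultimately show ?thesis
    by (simp add: hyp0F1_def[abs_def])
qed

text \<open>Since differentiation raises the parameter, this three-term relation is the differential
  equation \<open>z \<phi>'' + a \<phi>' = \<phi>\<close> of \<open>\<phi> = \<^sub>0F\<^sub>1(a; \<cdot>)\<close>. It holds coefficient by coefficient.\<close>

lemma hyp0F1_contiguous:
  assumes "1 \<le> a"
  shows "z * hyp0F1 (Suc (Suc a)) z / (real a * (real a + 1)) + hyp0F1 (Suc a) z = hyp0F1 a z"
proof -
  let ?p = "\<lambda>b k. pochhammer (real b) k * fact k"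
  \<comment> \<open>The factor \<open>z\<close> shifts the first series by one, so its coefficients start with a zero.\<close>
  define f where "f k = (case k of 0 \<Rightarrow> 0 |
    Suc j \<Rightarrow> z * (z ^ j / ?p (Suc (Suc a)) j) / (real a * (real a + 1)))" for k
  have "(\<lambda>k. f (Suc k)) sums (z * hyp0F1 (Suc (Suc a)) z / (real a * (real a + 1)))"
    unfolding f_def nat.case by (intro sums_divide sums_mult hyp0F1_sums) simp
  then have "f sums (z * hyp0F1 (Suc (Suc a)) z / (real a * (real a + 1)))"
    by (subst (asm) sums_Suc_iff) (simp add: f_def)
  then have "(\<lambda>k. f k + z ^ k / ?p (Suc a) k) sums
      (z * hyp0F1 (Suc (Suc a)) z / (real a * (real a + 1)) + hyp0F1 (Suc a) z)"
    by (intro sums_add hyp0F1_sums) simp_all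
  moreover have "f k + z ^ k / ?p (Suc a) k = z ^ k / ?p a k" for k
  proof (cases k)
    case (Suc j)
    have ge: "1 \<le> pochhammer (real a + 2) j" by (rule pochhammer_ge_one) simp
    have s: "real (Suc (Suc a)) = real a + 2" "real (Suc a) = real a + 1" by simp_all
    have pa: "pochhammer (real a) (Suc j) = real a * pochhammer (real a + 1) j"
      by (simp add: pochhammer_rec)
    have pa1: "pochhammer (real a + 1) (Suc j) = (real a + 1) * pochhammer (real a + 2) j"
      by (simp add: pochhammer_rec add.assoc)
    have pa1': "pochhammer (real a + 1) j * (real a + 1 + real j)
        = (real a + 1) * pochhammer (real a + 2) j"
      using pa1 by (simp add: pochhammer_Suc)
    define q where "q = pochhammer (real a + 2) j"
    define r where "r = pochhammer (real a + 1) j"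
    have qr: "(real a + 1) * q = r * (real a + 1 + real j)"
      using pa1' by (simp add: q_def r_def)
    have r1: "1 \<le> r" unfolding r_def by (rule pochhammer_ge_one) simp
    have q1: "q = r * (real a + 1 + real j) / (real a + 1)"
      using qr by (simp add: field_simps)
    have "f k + z ^ k / ?p (Suc a) k = z * (z ^ j / (q * fact j)) / (real a * (real a + 1))
       + z ^ Suc j / ((real a + 1) * q * fact (Suc j))"
      unfolding f_def Suc nat.case s pa1 q_def[symmetric] by simp
    also have "\<dots> = z ^ Suc j / (r * (real a + 1 + real j) * fact j)
        * (1 / real a + 1 / (1 + real j))"
      unfolding qr q1 using r1 assms by (simp add: divide_simps) (simp add: algebra_simps)
    also have "1 / real a + 1 / (1 + real j) = (real a + 1 + real j) / (real a * (1 + real j))"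
      using assms by (simp add: divide_simps)
    also have "z ^ Suc j / (r * (real a + 1 + real j) * fact j) * \<dots>
        = z ^ Suc j / (real a * r * fact (Suc j))"
      using r1 assms by (simp add: divide_simps)
    finally show ?thesis
      unfolding Suc pa r_def by simp
  qed (simp add: f_def)
  ultimately show ?thesis
    using hyp0F1_sums[OF assms, of z] by (simp add: sums_iff)
qed

lemma continuous_on_hyp0F1 [continuous_intros]:
  assumes "1 \<le> a" "continuous_on S f"
  shows "continuous_on S (\<lambda>x. hyp0F1 a (f x))"
proof -
  have "continuous_on UNIV (hyp0F1 a)"
    using hyp0F1_deriv[OF assms(1)]
    by (auto intro!: continuous_at_imp_continuous_on DERIV_isCont)
  from continuous_on_compose2[OF this assms(2)] show ?thesis by simp
qed

section \<open>The integrand\<close>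

definition integrand :: "nat \<Rightarrow> nat \<Rightarrow> real \<Rightarrow> real \<Rightarrow> real" where
  "integrand k a t y = t ^ k * exp (- t) * hyp0F1 a (t * y)"

lemma Hint_eq: "Hint k a x y = (LBINT t=0..x. integrand k a t y)"
  by (simp add: Hint_def integrand_def)

lemma continuous_on_integrand [continuous_intros]:
  assumes "1 \<le> a" "continuous_on S f" "continuous_on S g"
  shows "continuous_on S (\<lambda>x. integrand k a (f x) (g x))"
  unfolding integrand_def using assms by (intro continuous_intros) auto

lemma integrand_deriv_y:
  assumes "1 \<le> a"
  shows "((\<lambda>y. integrand k a t y) has_real_derivative integrand (Suc k) (Suc a) t y / real a) (at y)"
proof -
  have "((\<lambda>y. hyp0F1 a (t * y)) has_real_derivative (hyp0F1 (Suc a) (t * y) / real a) * t) (at y)"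
    by (rule DERIV_chain2[OF hyp0F1_deriv[OF assms]]) (auto intro!: derivative_eq_intros)
  from DERIV_cmult[OF this, of "t ^ k * exp (- t)"] show ?thesis
    by (simp add: integrand_def mult_ac)
qed

definition integrand_dt :: "nat \<Rightarrow> nat \<Rightarrow> real \<Rightarrow> real \<Rightarrow> real" where
  "integrand_dt k a t y = (real k * t ^ (k - 1) - t ^ k) * exp (- t) * hyp0F1 a (t * y)
     + t ^ k * exp (- t) * (hyp0F1 (Suc a) (t * y) / real a * y)"

lemma integrand_deriv_t:
  assumes "1 \<le> a"
  shows "((\<lambda>t. integrand k a t y) has_real_derivative integrand_dt k a t y) (at t)"
proof -
  have h: "((\<lambda>t. hyp0F1 a (t * y)) has_real_derivative (hyp0F1 (Suc a) (t * y) / real a) * y) (at t)"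
    by (rule DERIV_chain2[OF hyp0F1_deriv[OF assms]]) (auto intro!: derivative_eq_intros)
  have e: "((\<lambda>t. t ^ k * exp (- t)) has_real_derivative
      (real k * t ^ (k - 1) - t ^ k) * exp (- t)) (at t)"
    by (auto intro!: derivative_eq_intros simp: algebra_simps)
  from DERIV_mult[OF e h] show ?thesis
    unfolding integrand_def integrand_dt_def by (simp add: mult_ac)
qed

lemma continuous_on_integrand_dt:
  assumes "1 \<le> a"
  shows "continuous_on S (\<lambda>t. integrand_dt k a t y)"
  unfolding integrand_dt_def using assms by (auto intro!: continuous_intros)

text \<open>The one place where the differential equation of \<open>\<^sub>0F\<^sub>1\<close> enters: the second \<open>y\<close>-derivative
  and \<open>a\<close> times the first combine to multiplication by \<open>t\<close>, which cancels the derivative of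
  \<open>e\<^sup>-\<^sup>t\<close>, while \<open>t \<partial>\<^sub>t\<close> and \<open>y \<partial>\<^sub>y\<close> agree on functions of \<open>t y\<close>. What is left is the degree
  \<open>k\<close> of the power of \<open>t\<close>.\<close>

lemma integrand_pde:
  assumes "1 \<le> a"
  shows "t * integrand_dt k a t y
     + (y * (integrand (Suc (Suc k)) (Suc (Suc a)) t y / real (Suc a) / real a)
        + (real a - y) * (integrand (Suc k) (Suc a) t y / real a))
     = real k * integrand k a t y"
proof -
  let ?e = "t ^ k * exp (- t)"
  have tk: "t * (real k * t ^ (k - 1)) = real k * t ^ k" by (cases k) simp_all
  have "y * (integrand (Suc (Suc k)) (Suc (Suc a)) t y / real (Suc a) / real a)
        + real a * (integrand (Suc k) (Suc a) t y / real a)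
      = ?e * t * ((t * y) * hyp0F1 (Suc (Suc a)) (t * y) / (real a * (real a + 1))
          + hyp0F1 (Suc a) (t * y))"
    unfolding integrand_def using assms by (simp add: field_simps)
  also have "\<dots> = ?e * t * hyp0F1 a (t * y)"
    by (simp only: hyp0F1_contiguous[OF assms])
  finally have 1: "y * (integrand (Suc (Suc k)) (Suc (Suc a)) t y / real (Suc a) / real a)
        + real a * (integrand (Suc k) (Suc a) t y / real a) = ?e * t * hyp0F1 a (t * y)" .
  have "t * integrand_dt k a t y
      = (t * (real k * t ^ (k - 1)) - t * t ^ k) * exp (- t) * hyp0F1 a (t * y)
        + y * (integrand (Suc k) (Suc a) t y / real a)"
    unfolding integrand_dt_def integrand_def by (simp add: algebra_simps)
  then have 2: "t * integrand_dt k a t y = real k * integrand k a t y - ?e * t * hyp0F1 a (t * y)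
        + y * (integrand (Suc k) (Suc a) t y / real a)"
    unfolding tk integrand_def by (simp add: algebra_simps)
  show ?thesis using 1 2 by (simp only: left_diff_distrib)
qed

section \<open>The incomplete integral\<close>

lemma Hint_deriv_x:
  assumes "1 \<le> a"
  shows "((\<lambda>x. Hint k a x y) has_real_derivative integrand k a x y) (at x)"
proof -
  \<comment> \<open>An interval with both \<open>0\<close> and \<open>x\<close> in its interior covers either sign of \<open>x\<close>.\<close>
  let ?l = "min 0 x - 1" and ?r = "max 0 x + 1"
  have "((\<lambda>u. LBINT t=ereal 0..ereal u. integrand k a t y)
      has_vector_derivative integrand k a x y) (at x within {?l..?r})"
    using assms by (intro interval_integral_FTC2 continuous_intros) auto
  moreover have "at x within {?l..?r} = at x"
    by (rule at_within_Icc_at) auto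
  ultimately show ?thesis
    by (simp add: Hint_eq has_real_derivative_iff_has_vector_derivative zero_ereal_def)
qed

text \<open>The Leibniz rule for the oriented integral: reversing the endpoints changes the sign on both
  sides, so the case \<open>a \<le> b\<close> suffices.\<close>

lemma interval_integral_deriv_param:
  fixes f fy :: "real \<Rightarrow> real \<Rightarrow> real"
  assumes deriv: "\<And>t y. ((\<lambda>y. f t y) has_real_derivative fy t y) (at y)"
    and cont: "\<And>y. continuous_on UNIV (\<lambda>t. f t y)"
    and cont': "continuous_on UNIV (\<lambda>(y, t). fy t y)"
  shows "((\<lambda>y. LBINT t=ereal a..ereal b. f t y) has_real_derivative
     (LBINT t=ereal a..ereal b. fy t y)) (at y)"
proof -
  have cont_fy: "continuous_on S (\<lambda>t. fy t y)" for S y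
  proof -
    have "continuous_on S (\<lambda>t. (y, t))" by (intro continuous_intros)
    from continuous_on_compose2[OF cont' this] show ?thesis by simp
  qed
  have *: "((\<lambda>y. LBINT t=ereal a..ereal b. f t y) has_real_derivative
     (LBINT t=ereal a..ereal b. fy t y)) (at y)" if "a \<le> b" for a b
  proof -
    have "((\<lambda>y. integral (cbox a b) (\<lambda>t. f t y)) has_real_derivative
        integral (cbox a b) (\<lambda>t. fy t y)) (at y within UNIV)"
    proof (rule leibniz_rule_field_derivative)
      show "(\<lambda>t. f t y) integrable_on cbox a b" for y
        by (intro integrable_continuous continuous_on_subset[OF cont]) simp
      show "continuous_on (UNIV \<times> cbox a b) (\<lambda>(y, t). fy t y)"
        by (rule continuous_on_subset[OF cont']) simp
    qed (use deriv in auto)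
    moreover have "(LBINT t=ereal a..ereal b. g t) = integral (cbox a b) g"
      if "continuous_on UNIV g" for g :: "real \<Rightarrow> real"
      using \<open>a \<le> b\<close> continuous_on_subset[OF that, of "{a..b}"]
      by (simp add: interval_integral_eq_integral borel_integrable_atLeastAtMost')
    ultimately show ?thesis by (simp add: cont cont_fy)
  qed
  show ?thesis
  proof (cases "a \<le> b")
    case False
    then show ?thesis
      using DERIV_minus[OF *[of b a]]
      by (simp add: interval_integral_endpoints_reverse[of "ereal a" "ereal b"])
  qed (rule *)
qed

lemma Hint_deriv_y:
  assumes "1 \<le> a"
  shows "((\<lambda>y. Hint k a x y) has_real_derivative Hint (Suc k) (Suc a) x y / real a) (at y)"
proof -
  have "((\<lambda>y. LBINT t=ereal 0..ereal x. integrand k a t y) has_real_derivative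
     (LBINT t=ereal 0..ereal x. integrand (Suc k) (Suc a) t y / real a)) (at y)"
    using assms
    by (intro interval_integral_deriv_param integrand_deriv_y)
       (auto intro!: continuous_intros simp: case_prod_unfold)
  then show ?thesis
    by (simp add: Hint_eq zero_ereal_def)
qed

text \<open>Integrating \<open>integrand_pde\<close> in \<open>t\<close>: as \<open>t \<partial>\<^sub>t g = \<partial>\<^sub>t (t g) - g\<close>, the eigenvalue rises by
  one and the boundary term at \<open>x\<close> is \<open>x\<close> times the \<open>x\<close>-derivative of the integral.\<close>

lemma Hint_pde:
  assumes "1 \<le> a"
  shows "x * integrand k a x y
     + (y * (Hint (Suc (Suc k)) (Suc (Suc a)) x y / real (Suc a) / real a)
        + (real a - y) * (Hint (Suc k) (Suc a) x y / real a))
     = (real k + 1) * Hint k a x y"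
proof -
  let ?I = "\<lambda>f. LBINT t=ereal 0..ereal x. f t"
  let ?g = "\<lambda>t. integrand k a t y" and ?g1 = "\<lambda>t. integrand (Suc k) (Suc a) t y"
    and ?g2 = "\<lambda>t. integrand (Suc (Suc k)) (Suc (Suc a)) t y"
  let ?A = "y / real (Suc a) / real a" and ?B = "(real a - y) / real a"
  have int: "interval_lebesgue_integrable lborel (ereal 0) (ereal x) f"
    if "continuous_on UNIV f" for f :: "real \<Rightarrow> real"
    using that by (intro interval_integrable_isCont) (auto simp: continuous_on_eq_continuous_at)
  have cg: "continuous_on S ?g" "continuous_on S ?g1" "continuous_on S ?g2" for S
    using assms by (auto intro!: continuous_intros)
  have "?I (\<lambda>t. (real k + 1) * ?g t - (?A * ?g2 t + ?B * ?g1 t))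
      = x * integrand k a x y - 0 * integrand k a 0 y"
  proof (rule interval_integral_FTC_finite)
    show "continuous_on {min 0 x..max 0 x} (\<lambda>t. (real k + 1) * ?g t - (?A * ?g2 t + ?B * ?g1 t))"
      by (intro continuous_intros cg)
    fix t assume "min 0 x \<le> t" "t \<le> max 0 x"
    \<comment> \<open>By the equation for the integrand, \<open>t g\<close> is an antiderivative.\<close>
    have "((\<lambda>t. t * ?g t) has_real_derivative 1 * ?g t + integrand_dt k a t y * t) (at t)"
      by (rule DERIV_mult[OF DERIV_ident integrand_deriv_t[OF assms]])
    moreover have "1 * ?g t + integrand_dt k a t y * t
        = (real k + 1) * ?g t - (?A * ?g2 t + ?B * ?g1 t)"
      using integrand_pde[OF assms, of t k y] by (simp add: algebra_simps)
    ultimately show "((\<lambda>t. t * ?g t) has_vector_derivative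
        (real k + 1) * ?g t - (?A * ?g2 t + ?B * ?g1 t)) (at t within {min 0 x..max 0 x})"
      by (simp add: has_real_derivative_iff_has_vector_derivative has_vector_derivative_at_within)
  qed
  moreover have "?I (\<lambda>t. (real k + 1) * ?g t - (?A * ?g2 t + ?B * ?g1 t))
      = (real k + 1) * ?I ?g - (?A * ?I ?g2 + ?B * ?I ?g1)"
    by (simp add: int cg continuous_intros)
  ultimately show ?thesis
    by (simp add: Hint_eq zero_ereal_def)
qed

section \<open>Eigenfunctions in several variables\<close>

text \<open>\<open>f\<close> is an eigenfunction, with eigenvalue \<open>c\<close>, of the part of the operator without
  constants; leaving the constants out is what makes eigenvalues additive under products. The
  derivatives are given explicitly because \<open>deriv\<close> has an arbitrary value where a function is not
  differentiable, so that an equation between values of \<open>deriv\<close> would not pass to sums and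
  products.\<close>

definition eigen_derivs ::
  "nat \<Rightarrow> real \<Rightarrow> real \<Rightarrow> (real \<Rightarrow> (nat \<Rightarrow> real) \<Rightarrow> real) \<Rightarrow> (real \<Rightarrow> (nat \<Rightarrow> real) \<Rightarrow> real)
    \<Rightarrow> (nat \<Rightarrow> real \<Rightarrow> (nat \<Rightarrow> real) \<Rightarrow> real) \<Rightarrow> (nat \<Rightarrow> real \<Rightarrow> (nat \<Rightarrow> real) \<Rightarrow> real) \<Rightarrow> bool" where
  "eigen_derivs m a c f fx f1 f2 \<longleftrightarrow>
     (\<forall>x lam. ((\<lambda>u. f u lam) has_real_derivative fx x lam) (at x)) \<and>
     (\<forall>k\<in>{1..m}. \<forall>x lam s.
        ((\<lambda>s. f x (lam(k := s))) has_real_derivative f1 k x (lam(k := s))) (at s)) \<and>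
     (\<forall>k\<in>{1..m}. \<forall>x lam s.
        ((\<lambda>s. f1 k x (lam(k := s))) has_real_derivative f2 k x (lam(k := s))) (at s)) \<and>
     (\<forall>x lam. x * fx x lam + (\<Sum>k=1..m. lam k * f2 k x lam + (a - lam k) * f1 k x lam)
        = c * f x lam)"

definition eigenfun ::
  "nat \<Rightarrow> real \<Rightarrow> real \<Rightarrow> (real \<Rightarrow> (nat \<Rightarrow> real) \<Rightarrow> real) \<Rightarrow> bool" where
  "eigenfun m a c f \<longleftrightarrow> (\<exists>fx f1 f2. eigen_derivs m a c f fx f1 f2)"

lemma eigenfun_diff_op:
  assumes "eigenfun m (real n - real m + 1) c f"
  shows "diff_op n m f x lam
    = (c - real m * real n + real m * (real m - 1) / 2 + 1) * f x lam"
proof -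
  obtain fx f1 f2 where
    fx: "\<And>x lam. ((\<lambda>u. f u lam) has_real_derivative fx x lam) (at x)"
    and f1: "\<And>k x lam s. k \<in> {1..m} \<Longrightarrow>
        ((\<lambda>s. f x (lam(k := s))) has_real_derivative f1 k x (lam(k := s))) (at s)"
    and f2: "\<And>k x lam s. k \<in> {1..m} \<Longrightarrow>
        ((\<lambda>s. f1 k x (lam(k := s))) has_real_derivative f2 k x (lam(k := s))) (at s)"
    and eq: "\<And>x lam. x * fx x lam
        + (\<Sum>k=1..m. lam k * f2 k x lam + (real n - real m + 1 - lam k) * f1 k x lam) = c * f x lam"
    using assms unfolding eigenfun_def eigen_derivs_def by (elim exE conjE) blast
  have px: "partial_x f x lam = fx x lam"
    unfolding partial_x_def by (rule DERIV_imp_deriv[OF fx])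
  have p1: "partial_lam k f x lam = f1 k x lam" if "k \<in> {1..m}" for k x lam
    unfolding partial_lam_def using DERIV_imp_deriv[OF f1[OF that, of x lam "lam k"]] by simp
  have p2: "partial_lam k (partial_lam k f) x lam = f2 k x lam" if "k \<in> {1..m}" for k
    unfolding partial_lam_def[of k "partial_lam k f"] p1[OF that]
    using DERIV_imp_deriv[OF f2[OF that, of x lam "lam k"]] by simp
  have "(\<Sum>k = 1..m. lam k * partial_lam k (partial_lam k f) x lam
          + (real n - real m + 1 - lam k) * partial_lam k f x lam - real n * f x lam)
      = (\<Sum>k=1..m. lam k * f2 k x lam + (real n - real m + 1 - lam k) * f1 k x lam)
        - real m * (real n * f x lam)"
    by (simp add: p1 p2 sum_subtractf)
  then show ?thesis
    unfolding diff_op_def px using eq[of x lam] by (simp add: algebra_simps)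
qed

lemma eigenfun_sum:
  assumes "\<And>i. i \<in> I \<Longrightarrow> eigenfun m a c (f i)"
  shows "eigenfun m a c (\<lambda>x lam. \<Sum>i\<in>I. w i * f i x lam)"
proof -
  have "\<forall>i\<in>I. \<exists>fx f1 f2. eigen_derivs m a c (f i) fx f1 f2"
    using assms unfolding eigenfun_def by blast
  then obtain fx f1 f2 where D: "\<And>i. i \<in> I \<Longrightarrow> eigen_derivs m a c (f i) (fx i) (f1 i) (f2 i)"
    by metis
  have fx: "\<And>i x lam. i \<in> I \<Longrightarrow> ((\<lambda>u. f i u lam) has_real_derivative fx i x lam) (at x)"
    and f1: "\<And>i k x lam s. i \<in> I \<Longrightarrow> k \<in> {1..m} \<Longrightarrow>
        ((\<lambda>s. f i x (lam(k := s))) has_real_derivative f1 i k x (lam(k := s))) (at s)"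
    and f2: "\<And>i k x lam s. i \<in> I \<Longrightarrow> k \<in> {1..m} \<Longrightarrow>
        ((\<lambda>s. f1 i k x (lam(k := s))) has_real_derivative f2 i k x (lam(k := s))) (at s)"
    and eq: "\<And>i x lam. i \<in> I \<Longrightarrow> x * fx i x lam
        + (\<Sum>k=1..m. lam k * f2 i k x lam + (a - lam k) * f1 i k x lam) = c * f i x lam"
    using D unfolding eigen_derivs_def by blast+
  show ?thesis
    unfolding eigenfun_def eigen_derivs_def
  proof (intro exI conjI ballI allI)
    show "((\<lambda>u. \<Sum>i\<in>I. w i * f i u lam) has_real_derivative (\<Sum>i\<in>I. w i * fx i x lam)) (at x)"
      for x lam by (intro DERIV_sum DERIV_cmult fx)
    show "((\<lambda>s. \<Sum>i\<in>I. w i * f i x (lam(k := s))) has_real_derivative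
        (\<Sum>i\<in>I. w i * f1 i k x (lam(k := s)))) (at s)" if "k \<in> {1..m}" for k x lam s
      using that by (intro DERIV_sum DERIV_cmult f1)
    show "((\<lambda>s. \<Sum>i\<in>I. w i * f1 i k x (lam(k := s))) has_real_derivative
        (\<Sum>i\<in>I. w i * f2 i k x (lam(k := s)))) (at s)" if "k \<in> {1..m}" for k x lam s
      using that by (intro DERIV_sum DERIV_cmult f2)
    fix x lam
    have "x * (\<Sum>i\<in>I. w i * fx i x lam) + (\<Sum>k=1..m. lam k * (\<Sum>i\<in>I. w i * f2 i k x lam)
          + (a - lam k) * (\<Sum>i\<in>I. w i * f1 i k x lam))
       = (\<Sum>i\<in>I. x * (w i * fx i x lam)) + (\<Sum>k=1..m. \<Sum>i\<in>I. w i *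
            (lam k * f2 i k x lam + (a - lam k) * f1 i k x lam))"
      by (simp add: sum_distrib_left flip: sum.distrib) (simp add: algebra_simps)
    also have "\<dots> = (\<Sum>i\<in>I. w i * (x * fx i x lam
        + (\<Sum>k=1..m. lam k * f2 i k x lam + (a - lam k) * f1 i k x lam)))"
      by (subst sum.swap) (simp add: sum_distrib_left sum.distrib algebra_simps)
    also have "\<dots> = c * (\<Sum>i\<in>I. w i * f i x lam)"
      unfolding sum_distrib_left by (rule sum.cong) (simp_all only: eq mult.left_commute)
    finally show "x * (\<Sum>i\<in>I. w i * fx i x lam) + (\<Sum>k=1..m. lam k * (\<Sum>i\<in>I. w i * f2 i k x lam)
          + (a - lam k) * (\<Sum>i\<in>I. w i * f1 i k x lam)) = c * (\<Sum>i\<in>I. w i * f i x lam)" .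
  qed
qed

text \<open>The operator is a derivation in \<open>x\<close> plus a sum of operators each acting on one \<open>\<lambda>\<^sub>k\<close>, hence
  on one factor; so separation of variables adds up the eigenvalues.\<close>

lemma eigenfun_prod:
  assumes ux: "\<And>l x y. l \<in> {1..m} \<Longrightarrow> ((\<lambda>x. u l x y) has_real_derivative ux l x y) (at x)"
    and u1: "\<And>l x y. l \<in> {1..m} \<Longrightarrow> ((\<lambda>y. u l x y) has_real_derivative u1 l x y) (at y)"
    and u2: "\<And>l x y. l \<in> {1..m} \<Longrightarrow> ((\<lambda>y. u1 l x y) has_real_derivative u2 l x y) (at y)"
    and eq: "\<And>l x y. l \<in> {1..m} \<Longrightarrow>
        x * ux l x y + (y * u2 l x y + (a - y) * u1 l x y) = c l * u l x y"
  shows "eigenfun m a (\<Sum>l=1..m. c l) (\<lambda>x lam. \<Prod>l=1..m. u l x (lam l))"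
proof -
  let ?rest = "\<lambda>k x lam. \<Prod>l\<in>{1..m}-{k}. u l x (lam l)"
  have split: "(\<Prod>l=1..m. u l x (lam l)) = u k x (lam k) * ?rest k x lam"
    if "k \<in> {1..m}" for k x lam
    using that by (intro prod.remove) auto
  have rest: "?rest k x (lam(k := s)) = ?rest k x lam" for k x lam s
    by (rule prod.cong) auto
  show ?thesis
    unfolding eigenfun_def eigen_derivs_def
  proof (intro exI conjI ballI allI)
    show "((\<lambda>x. \<Prod>l=1..m. u l x (lam l)) has_real_derivative
        (\<Sum>k=1..m. ux k x (lam k) * ?rest k x lam)) (at x)" for x lam
      by (rule has_field_derivative_prod[OF ux])
    show "((\<lambda>s. \<Prod>l=1..m. u l x ((lam(k := s)) l)) has_real_derivative
        u1 k x ((lam(k := s)) k) * ?rest k x (lam(k := s))) (at s)" if "k \<in> {1..m}" for k x lam s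
      unfolding split[OF that] rest fun_upd_same by (rule DERIV_cmult_right[OF u1[OF that]])
    show "((\<lambda>s. u1 k x ((lam(k := s)) k) * ?rest k x (lam(k := s))) has_real_derivative
        u2 k x ((lam(k := s)) k) * ?rest k x (lam(k := s))) (at s)" if "k \<in> {1..m}" for k x lam s
      unfolding rest fun_upd_same by (rule DERIV_cmult_right[OF u2[OF that]])
    fix x lam
    have "x * (\<Sum>k=1..m. ux k x (lam k) * ?rest k x lam)
        + (\<Sum>k=1..m. lam k * (u2 k x (lam k) * ?rest k x lam)
            + (a - lam k) * (u1 k x (lam k) * ?rest k x lam))
      = (\<Sum>k=1..m. (x * ux k x (lam k) + (lam k * u2 k x (lam k) + (a - lam k) * u1 k x (lam k)))
            * ?rest k x lam)"
      by (simp add: sum_distrib_left algebra_simps flip: sum.distrib)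
    also have "\<dots> = (\<Sum>k=1..m. c k * (\<Prod>l=1..m. u l x (lam l)))"
      by (rule sum.cong) (simp_all only: eq split mult.assoc)
    also have "\<dots> = (\<Sum>l=1..m. c l) * (\<Prod>l=1..m. u l x (lam l))"
      by (simp only: sum_distrib_right)
    finally show "x * (\<Sum>k=1..m. ux k x (lam k) * ?rest k x lam)
        + (\<Sum>k=1..m. lam k * (u2 k x (lam k) * ?rest k x lam)
            + (a - lam k) * (u1 k x (lam k) * ?rest k x lam))
      = (\<Sum>l=1..m. c l) * (\<Prod>l=1..m. u l x (lam l))" .
  qed
qed

section \<open>Expansion of the determinant\<close>

definition expansion_term :: "nat \<Rightarrow> nat \<Rightarrow> (nat \<Rightarrow> nat) \<Rightarrow> nat \<Rightarrow> real \<Rightarrow> (nat \<Rightarrow> real) \<Rightarrow> real" where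
  "expansion_term a m e r x lam =
     (\<Prod>l=1..m. (if l = r then integrand else Hint) (e l) a x (lam l))"

text \<open>A summand is indexed by the permutation \<open>p\<close> of the Leibniz formula and by the row \<open>r\<close> that the
  product rule differentiates. Rows are numbered from 1 and matrix indices from 0, hence
  \<open>p (l - 1) + 1\<close>.\<close>

lemma Rfun_expansion:
  "Rfun n m x lam = (\<Sum>(p, r)\<in>{p. p permutes {0..<m}} \<times> {1..m}.
     signof p * expansion_term (n - m + 1) m (\<lambda>l. n - (p (l - 1) + 1)) r x lam)"
proof -
  let ?a = "n - m + 1" and ?e = "\<lambda>p l. n - (p (l - 1) + 1)"
  have det: "Determinant.det (Hmat n m u lam)
      = (\<Sum>p\<in>{p. p permutes {0..<m}}. signof p * (\<Prod>l=1..m. Hint (?e p l) ?a u (lam l)))" for u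
  proof -
    have "(\<Prod>i=0..<m. Hmat n m u lam $$ (i, p i)) = (\<Prod>l=1..m. Hint (?e p l) ?a u (lam l))"
      if "p permutes {0..<m}" for p
    proof -
      have "p i < m" if "i < m" for i
        using permutes_in_image[OF \<open>p permutes {0..<m}\<close>, of i] that by simp
      then show ?thesis
        by (simp add: prod.atLeast1_atMost_eq lessThan_atLeast0 Hmat_def)
    qed
    then show ?thesis
      by (subst det_def') (auto simp: Hmat_def intro!: sum.cong)
  qed
  have factor: "integrand (e r) ?a x (lam r) * (\<Prod>l\<in>{1..m}-{r}. Hint (e l) ?a x (lam l))
      = expansion_term ?a m e r x lam" if "r \<in> {1..m}" for r e
    unfolding expansion_term_def using that
    by (subst prod.remove[of _ r]) (auto intro!: prod.cong)
  have "((\<lambda>u. Determinant.det (Hmat n m u lam)) has_real_derivative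
     (\<Sum>p\<in>{p. p permutes {0..<m}}. signof p * (\<Sum>r=1..m. integrand (?e p r) ?a x (lam r)
         * (\<Prod>l\<in>{1..m}-{r}. Hint (?e p l) ?a x (lam l))))) (at x)"
    unfolding det
    by (intro DERIV_sum DERIV_cmult has_field_derivative_prod Hint_deriv_x) simp
  then have "Rfun n m x lam = (\<Sum>p\<in>{p. p permutes {0..<m}}. signof p *
      (\<Sum>r=1..m. integrand (?e p r) ?a x (lam r) * (\<Prod>l\<in>{1..m}-{r}. Hint (?e p l) ?a x (lam l))))"
    unfolding Rfun_def by (rule DERIV_imp_deriv)
  also have "\<dots> = (\<Sum>p\<in>{p. p permutes {0..<m}}. \<Sum>r=1..m.
      signof p * expansion_term ?a m (?e p) r x lam)"
    unfolding sum_distrib_left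
  proof (intro sum.cong refl)
    fix p r assume "r \<in> {1..m}"
    then show "signof p * (integrand (?e p r) ?a x (lam r)
        * (\<Prod>l\<in>{1..m}-{r}. Hint (?e p l) ?a x (lam l))) = signof p * expansion_term ?a m (?e p) r x lam"
      by (subst factor[of r "?e p"]) simp_all
  qed
  finally show ?thesis by (simp only: sum.cartesian_product)
qed

lemma eigenfun_expansion_term:
  assumes "1 \<le> a" "r \<in> {1..m}"
  shows "eigenfun m (real a) ((\<Sum>l=1..m. real (e l) + 1) - 1) (expansion_term a m e r)"
proof -
  \<comment> \<open>Differentiation in \<open>x\<close> lowers the eigenvalue of the factor in row \<open>r\<close> by one.\<close>
  define c where "c l = real (e l) + (if l = r then 0 else 1)" for l
  have "eigenfun m (real a) (\<Sum>l=1..m. c l)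
      (\<lambda>x lam. \<Prod>l=1..m. (if l = r then integrand else Hint) (e l) a x (lam l))"
  proof (rule eigenfun_prod)
    fix l x y
    show "((\<lambda>x. (if l = r then integrand else Hint) (e l) a x y) has_real_derivative
        (if l = r then integrand_dt else integrand) (e l) a x y) (at x)"
      using assms by (simp add: integrand_deriv_t Hint_deriv_x)
    show "((\<lambda>y. (if l = r then integrand else Hint) (e l) a x y) has_real_derivative
        (if l = r then integrand else Hint) (Suc (e l)) (Suc a) x y / real a) (at y)"
      using assms by (simp add: integrand_deriv_y Hint_deriv_y)
    show "((\<lambda>y. (if l = r then integrand else Hint) (Suc (e l)) (Suc a) x y / real a)
        has_real_derivative (if l = r then integrand else Hint) (Suc (Suc (e l))) (Suc (Suc a)) x y
          / real (Suc a) / real a) (at y)"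
      by (intro DERIV_cdivide) (simp add: integrand_deriv_y Hint_deriv_y del: of_nat_Suc)
    show "x * (if l = r then integrand_dt else integrand) (e l) a x y
        + (y * ((if l = r then integrand else Hint) (Suc (Suc (e l))) (Suc (Suc a)) x y
            / real (Suc a) / real a)
          + (real a - y) * ((if l = r then integrand else Hint) (Suc (e l)) (Suc a) x y / real a))
        = c l * (if l = r then integrand else Hint) (e l) a x y"
      using integrand_pde[OF assms(1), of x "e l" y] Hint_pde[OF assms(1), of x "e l" y]
      by (cases "l = r") (simp_all add: c_def del: of_nat_Suc)
  qed
  moreover have "(\<Sum>l=1..m. c l) = (\<Sum>l=1..m. real (e l) + 1) - 1"
  proof -
    have "(\<Sum>l=1..m. c l) = (\<Sum>l=1..m. (real (e l) + 1) - (if l = r then 1 else 0))"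
      by (rule sum.cong) (auto simp: c_def)
    then show ?thesis using assms(2) by (simp add: sum_subtractf)
  qed
  ultimately show ?thesis
    by (simp add: expansion_term_def[abs_def])
qed

text \<open>The left side is the sum of the eigenvalues of all factors \<open>H\<^sup>k\<close> in one product of the
  Leibniz formula. It does not depend on \<open>p\<close>, since \<open>p\<close> only rearranges the columns.\<close>

lemma sum_exponents:
  assumes "m \<le> n" "p permutes {0..<m}"
  shows "(\<Sum>l=1..m. real (n - (p (l - 1) + 1)) + 1) = real m * real n - real m * (real m - 1) / 2"
proof -
  have "(\<Sum>l=1..m. real (n - (p (l - 1) + 1)) + 1) = (\<Sum>i=0..<m. real (n - (p i + 1)) + 1)"
    by (simp add: sum.atLeast1_atMost_eq lessThan_atLeast0)
  also have "\<dots> = (\<Sum>i=0..<m. real n - real (p i))"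
  proof (rule sum.cong)
    fix i assume "i \<in> {0..<m}"
    then have "p i < m" using permutes_in_image[OF assms(2), of i] by simp
    then show "real (n - (p i + 1)) + 1 = real n - real (p i)"
      using assms(1) by (simp add: of_nat_diff)
  qed simp
  also have "\<dots> = real m * real n - (\<Sum>i=0..<m. real (p i))"
    by (simp add: sum_subtractf)
  also have "(\<Sum>i=0..<m. real (p i)) = (\<Sum>i=0..<m. real i)"
    using sum.permute[OF assms(2), of real] by (simp add: comp_def)
  also have "\<dots> = real m * (real m - 1) / 2"
    by (induction m) (simp_all add: field_simps)
  finally show ?thesis .
qed

theorem theorem2p2:
  fixes n m :: nat and x :: real and lam :: "nat \<Rightarrow> real"
  assumes "1 \<le> m" and "m \<le> n"
  shows "diff_op n m (Rfun n m) x lam = 0"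
proof -
  let ?c = "real m * real n - real m * (real m - 1) / 2 - 1"
  let ?I = "{p. p permutes {0..<m}} \<times> {1..m}"
  let ?f = "\<lambda>(p, r). expansion_term (n - m + 1) m (\<lambda>l. n - (p (l - 1) + 1)) r"
  have "eigenfun m (real (n - m + 1)) ?c (?f i)" if i: "i \<in> ?I" for i
  proof -
    obtain p r where pr: "i = (p, r)" "p permutes {0..<m}" "r \<in> {1..m}"
      using i by auto
    show ?thesis
      using eigenfun_expansion_term[of "n - m + 1" r m "\<lambda>l. n - (p (l - 1) + 1)"] pr
      by (simp only: sum_exponents[OF assms(2) pr(2)] prod.case)
  qed
  then have "eigenfun m (real (n - m + 1)) ?c
      (\<lambda>x lam. \<Sum>i\<in>?I. (case i of (p, r) \<Rightarrow> signof p) * ?f i x lam)"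
    by (rule eigenfun_sum)
  moreover have "(\<lambda>x lam. \<Sum>i\<in>?I. (case i of (p, r) \<Rightarrow> signof p) * ?f i x lam) = Rfun n m"
    by (intro ext) (simp add: Rfun_expansion case_prod_unfold)
  moreover have "real (n - m + 1) = real n - real m + 1"
    using assms by (simp add: of_nat_diff)
  ultimately have "eigenfun m (real n - real m + 1) ?c (Rfun n m)"
    by (simp only:)
  from eigenfun_diff_op[OF this, of x lam] show ?thesis by simp
qed

end
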